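(* Let $n \geq 2$ be an integer and let $\rho$ be a real number with $$0 < \rho \leq \frac{n^2-1}{2n^{n+1}-n^2-1}.$$ Then $P_{n,\rho} := \{x \in [0,1]^n : \sum_{i=1}^n x_i \leq n-\rho\}$ has $\mathrm{Las}$-rank $n$.
   Context: Notation. $[n] := \{1,\ldots,n\}$. For $P \subseteq [0,1]^n$, the integer hull is $P_I := \mathrm{conv}(P \cap \{0,1\}^n)$. Let $\mathcal{F} := \{0,1\}^n$. For $S \subseteq [n]$ let $S|_1 := \{x \in \mathcal{F} : x_i = 1\ \forall i \in S\}$ (so $\emptyset|_1 = \mathcal{F}$), and write $i|_1$ for $\{i\}|_1$. For an integer $\ell \geq 0$ let $\mathcal{A}_\ell^+ := \{S|_1 : S \subseteq [n],\ |S| \leq \ell\}$. For a vector $y$ indexed by a family containing $\mathcal{F}$ and all $i|_1$, let $\hat{x}(y) := (y_{\mathcal{F}}, y_{1|_1},\ldots,y_{n|_1})^\top$. For a matrix $Y$, $Ye_\alpha$ is its column indexed by $\alpha$. The Lasserre operator. Let $P := \{x \in [0,1]^n : Ax \leq b\}$ with $A \in \mathbb{R}^{m \times n}$, $b \in \mathbb{R}^m$ (the operator is applied to this explicit description), and let $k \geq 1$ be an integer. Let $\widehat{\mathrm{Las}}^k(P)$ be the set of real symmetric positive semidefinite matrices $Y$ with rows and columns indexed by $\mathcal{A}_{k+1}^+$ such that: (Las1) $Y[\mathcal{F},\mathcal{F}] = 1$; (Las2) for every $i \in [m]$, the symmetric matrix $Y^i$ indexed by $\mathcal{A}_k^+$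 with entries $Y^i[S|_1,S'|_1] := b_i Y[S|_1,S'|_1] - \sum_{j=1}^n A[i,j]\, Y[(S\cup\{j\})|_1,(S'\cup\{j\})|_1]$ is positive semidefinite; (Las3) for all $\alpha_1,\alpha_2,\beta_1,\beta_2 \in \mathcal{A}_{k+1}^+$ with $\alpha_1\cap\beta_1 = \alpha_2\cap\beta_2$: $Y[\alpha_1,\beta_1] = Y[\alpha_2,\beta_2]$. Then $\mathrm{Las}^k(P) := \{x \in \mathbb{R}^n : \exists\, Y \in \widehat{\mathrm{Las}}^k(P),\ \hat{x}(Ye_{\mathcal{F}}) = (1,x)^\top\}$, and $\mathrm{Las}^0(P) := P$. The $\mathrm{Las}$-rank of $P$ is the smallest integer $k \geq 0$ such that $\mathrm{Las}^k(P) = P_I$. Here $P_{n,\rho}$ is described by the single inequality $\sum_{i=1}^n x_i \leq n-\rho$ (in addition to the box $[0,1]^n$). *)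

theory Defs
  imports "HOL-Analysis.Analysis"
begin

text \<open>The ground set \<open>[n]\<close> is the finite type \<open>'n\<close>, so that \<open>n = CARD('n)\<close>; the rows of a
  system \<open>A x \<le> b\<close> are indexed by the finite type \<open>'m\<close>.\<close>

definition cube01 :: "(real^'n) set" where
  "cube01 = {x. \<forall>i. x $ i \<in> {0, 1}}"

definition integer_hull :: "(real^'n) set \<Rightarrow> (real^'n) set" where
  "integer_hull P = convex hull (P \<inter> cube01)"

definition ones :: "'n set \<Rightarrow> (real^'n) set" where
  "ones S = {x \<in> cube01. \<forall>i\<in>S. x $ i = 1}"

definition aplus :: "nat \<Rightarrow> (real^'n) set set" where
  "aplus l = {ones S |S. card S \<le> l}"

text \<open>A matrix with rows and columns indexed by a finite set \<open>I\<close> is a binary function, of which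
  only the values on \<open>I \<times> I\<close> matter.\<close>

definition sym_psd_on :: "'a set \<Rightarrow> ('a \<Rightarrow> 'a \<Rightarrow> real) \<Rightarrow> bool" where
  "sym_psd_on I M \<longleftrightarrow>
     (\<forall>a\<in>I. \<forall>b\<in>I. M a b = M b a) \<and>
     (\<forall>v. 0 \<le> (\<Sum>a\<in>I. \<Sum>b\<in>I. v a * M a b * v b))"

definition box_polytope :: "real^'n^'m \<Rightarrow> real^'m \<Rightarrow> (real^'n) set" where
  "box_polytope A b =
     {x. (\<forall>j. 0 \<le> x $ j \<and> x $ j \<le> 1) \<and> (\<forall>i. (A *v x) $ i \<le> b $ i)}"

text \<open>The matrix \<open>Y\<^sup>i\<close> of the \<open>i\<close>-th inequality. Its index \<open>S \<union> {j}\<close> is expressed by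
  intersecting with \<open>ones {j}\<close>; \<open>slack_matrix_ones\<close> below is the formula in terms of \<open>S\<close>.\<close>

definition slack_matrix ::
  "real^'n^'m \<Rightarrow> real^'m \<Rightarrow> ((real^'n) set \<Rightarrow> (real^'n) set \<Rightarrow> real) \<Rightarrow> 'm
    \<Rightarrow> (real^'n) set \<Rightarrow> (real^'n) set \<Rightarrow> real" where
  "slack_matrix A b Y i \<alpha> \<beta> =
     b $ i * Y \<alpha> \<beta> - (\<Sum>j\<in>UNIV. A $ i $ j * Y (\<alpha> \<inter> ones {j}) (\<beta> \<inter> ones {j}))"

lemma ones_empty: "ones {} = cube01"
  by (simp add: ones_def)

lemma ones_Un: "ones (S \<union> T) = ones S \<inter> ones T"
  by (auto simp: ones_def)

lemma inj_ones: "inj (ones :: 'n::finite set \<Rightarrow> (real^'n) set)"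
proof (rule injI)
  fix S T :: "'n set"
  assume eq: "(ones S :: (real^'n) set) = ones T"
  have U: "U = {i. \<forall>x\<in>(ones U :: (real^'n) set). x $ i = 1}" for U :: "'n set"
  proof -
    let ?c = "(\<chi> i. if i \<in> U then 1 else 0) :: real^'n"
    have c: "?c \<in> ones U"
      by (simp add: ones_def cube01_def)
    show ?thesis
    proof (intro set_eqI iffI)
      fix i assume "i \<in> U"
      then show "i \<in> {i. \<forall>x\<in>(ones U :: (real^'n) set). x $ i = 1}"
        by (simp add: ones_def)
    next
      fix i assume "i \<in> {i. \<forall>x\<in>(ones U :: (real^'n) set). x $ i = 1}"
      with c have "?c $ i = 1" by blast
      then show "i \<in> U" by (simp split: if_splits)
    qed
  qed
  show "S = T" using U[of S] U[of T] unfolding eq by (rule trans[OF _ sym])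
qed

lemma slack_matrix_ones:
  "slack_matrix A b Y i (ones S) (ones S') =
     b $ i * Y (ones S) (ones S')
     - (\<Sum>j\<in>UNIV. A $ i $ j * Y (ones (S \<union> {j})) (ones (S' \<union> {j})))"
  by (simp only: slack_matrix_def ones_Un)

definition las_lift ::
  "nat \<Rightarrow> real^'n^'m \<Rightarrow> real^'m \<Rightarrow> ((real^'n) set \<Rightarrow> (real^'n) set \<Rightarrow> real) set" where
  "las_lift k A b = {Y.
     sym_psd_on (aplus (k + 1)) Y \<and>
     Y cube01 cube01 = 1 \<and>
     (\<forall>i. sym_psd_on (aplus k) (slack_matrix A b Y i)) \<and>
     (\<forall>\<alpha>1\<in>aplus (k + 1). \<forall>\<alpha>2\<in>aplus (k + 1). \<forall>\<beta>1\<in>aplus (k + 1). \<forall>\<beta>2\<in>aplus (k + 1).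
        \<alpha>1 \<inter> \<beta>1 = \<alpha>2 \<inter> \<beta>2 \<longrightarrow> Y \<alpha>1 \<beta>1 = Y \<alpha>2 \<beta>2)}"

definition las :: "nat \<Rightarrow> real^'n^'m \<Rightarrow> real^'m \<Rightarrow> (real^'n) set" where
  "las k A b =
     (if k = 0 then box_polytope A b
      else {x. \<exists>Y\<in>las_lift k A b. Y cube01 cube01 = 1 \<and> (\<forall>i. Y (ones {i}) cube01 = x $ i)})"

text \<open>\<open>k\<close> is the smallest level at which the integer hull is reached. This is a relation rather
  than a \<open>LEAST\<close> term, so that it also asserts that such a level exists.\<close>

definition has_las_rank :: "real^'n^'m \<Rightarrow> real^'m \<Rightarrow> nat \<Rightarrow> bool" where
  "has_las_rank A b k \<longleftrightarrow>
     las k A b = integer_hull (box_polytope A b) \<and>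
     (\<forall>j<k. las j A b \<noteq> integer_hull (box_polytope A b))"

text \<open>The description of \<open>P\<^bsub>n,\<rho>\<^esub>\<close> by one inequality, hence with the one-element row type.\<close>

definition P_mat :: "real^'n^1" where
  "P_mat = (\<chi> i j. 1)"

definition P_rhs :: "nat \<Rightarrow> real \<Rightarrow> real^1" where
  "P_rhs n \<rho> = (\<chi> i. real n - \<rho>)"

lemma box_polytope_P:
  "box_polytope P_mat (P_rhs n \<rho>) =
     {x. (\<forall>j. 0 \<le> x $ j \<and> x $ j \<le> 1) \<and> (\<Sum>j\<in>UNIV. x $ j) \<le> real n - \<rho>}"
  by (simp add: box_polytope_def P_mat_def P_rhs_def matrix_vector_mult_def)

end

theory Submission
  imports Defs
begin

text \<open>A signed measure \<open>p\<close> on the vertices of the cube, i.e. on the subsets of \<open>[n]\<close>, has a moment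
  matrix with entries \<open>p(\<alpha> \<inter> \<beta>)\<close>. Its quadratic form at \<open>v\<close> is \<open>\<Sum>\<^sub>T p(T) g(T)\<^sup>2\<close>, where
  \<open>g = \<Sum>\<^sub>\<alpha> v\<^sub>\<alpha> 1\<^sub>\<alpha>\<close>; over \<open>\<alpha> = S|\<^sub>1\<close> with \<open>|S| \<le> k\<close> these \<open>g\<close> are exactly the multilinear polynomials
  of degree at most \<open>k\<close>. Passing to the slack matrix of a row \<open>a x \<le> b\<close> only multiplies the measure by the
  slack \<open>b - a x\<close> (lemma \<open>slack_matrix_moment_matrix\<close>). Both bounds are read off from these forms.

  \<^emph>\<open>Level n gives the integer hull.\<close> With no degree restriction, Moebius inversion makes every \<open>Y\<close> a
  moment matrix, and \<open>g\<close> may be the indicator of a single vertex. Hence \<open>p\<close> is nonnegative and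
  vanishes at vertices that violate a constraint, so its barycenter is in the hull
  (\<open>las_card_subset_integer_hull\<close>). This half holds for every system of inequalities.

  \<^emph>\<open>Levels below n do not.\<close> For \<open>k < n\<close> a polynomial \<open>g\<close> of degree at most \<open>k\<close> is orthogonal to the
  character \<open>(-1)\<^bsup>|T|\<^esup>\<close>, so \<open>g([n])\<close> is a signed sum of the values of \<open>g\<close> at the other vertices. By
  Cauchy-Schwarz a small negative weight at \<open>[n]\<close>, the only vertex with \<open>|T| > n - \<rho>\<close>, is
  therefore outweighed by the positive weights elsewhere (\<open>truncated_moment_matrix_psd\<close>). It remains to choose a
  probability measure that charges \<open>[n]\<close>, has mean cardinality above \<open>n - 1\<close>, and satisfies this
  smallness condition (\<open>fooling_measure_exists\<close>); its barycenter survives but violates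
  \<open>\<Sum> x\<^sub>i \<le> n - 1\<close>, which is valid on the hull. With \<open>N = 2\<^sup>n - n - 1\<close> the number of vertices
  below level \<open>n - 1\<close>, such a measure exists as soon as \<open>\<rho> N\<^sup>2 < 1\<close>, and the hypothesis on \<open>\<rho>\<close>
  implies this (\<open>bound_on_low_vertices\<close>).\<close>

section \<open>Moment matrices of signed measures on the cube\<close>

definition vertex :: "'n set \<Rightarrow> real^'n" where
  "vertex T = (\<chi> i. of_bool (i \<in> T))"

definition moment_matrix ::
  "('n set \<Rightarrow> real) \<Rightarrow> (real^'n) set \<Rightarrow> (real^'n) set \<Rightarrow> real" where
  "moment_matrix p \<alpha> \<beta> = (\<Sum>T\<in>UNIV. p T * of_bool (vertex T \<in> \<alpha> \<inter> \<beta>))"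

lemma vertex_nth: "vertex T $ i = of_bool (i \<in> T)"
  by (simp add: vertex_def)

lemma vertex_in_ones_iff: "vertex T \<in> ones S \<longleftrightarrow> S \<subseteq> T"
  by (auto simp: vertex_def ones_def cube01_def)

lemma vertex_in_cube01: "vertex T \<in> cube01"
  by (simp add: vertex_def cube01_def)

lemma inj_vertex: "inj vertex"
  by (rule injI) (simp add: vec_eq_iff vertex_nth of_bool_eq_iff set_eq_iff)

lemma cube01_eq_range_vertex: "cube01 = range vertex"
proof (intro equalityI subsetI)
  fix x :: "real^'a" assume "x \<in> cube01"
  then have "x = vertex {i. x $ i = 1}"
    by (auto simp: cube01_def vertex_def vec_eq_iff)
  then show "x \<in> range vertex" by blast
qed (auto simp: vertex_in_cube01)

lemma sum_vertex: "(\<Sum>j\<in>UNIV. vertex T $ j) = real (card T)"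
  by (simp add: vertex_def Groups_Big.sum_of_bool_eq)

lemma matrix_vector_mult_vertex:
  "(A *v vertex T) $ i = (\<Sum>j\<in>UNIV. A $ i $ j * of_bool (j \<in> T))"
  by (simp add: matrix_vector_mult_def vertex_def)

lemma aplus_eq_range_ones:
  assumes "CARD('n) \<le> l" shows "(aplus l :: (real^'n) set set) = range ones"
  using assms card_mono[of "UNIV :: 'n set"] by (fastforce simp: aplus_def intro: order_trans)

text \<open>The matrix is \<open>\<Sum>\<^sub>T p(T) e\<^sub>T e\<^sub>T\<^sup>t\<close> for the incidence vectors \<open>e\<^sub>T = (1\<^sub>\<alpha>(T))\<^sub>\<alpha>\<close>, so its
  form is a weighted sum of squares.\<close>

lemma moment_matrix_quadratic_form:
  "(\<Sum>\<alpha>\<in>I. \<Sum>\<beta>\<in>I. v \<alpha> * moment_matrix p \<alpha> \<beta> * v \<beta>) =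
     (\<Sum>T\<in>UNIV. p T * (\<Sum>\<alpha>\<in>I. v \<alpha> * of_bool (vertex T \<in> \<alpha>))\<^sup>2)"
proof -
  have "(\<Sum>\<alpha>\<in>I. \<Sum>\<beta>\<in>I. v \<alpha> * moment_matrix p \<alpha> \<beta> * v \<beta>) =
    (\<Sum>\<alpha>\<in>I. \<Sum>\<beta>\<in>I. \<Sum>T\<in>UNIV.
       p T * ((v \<alpha> * of_bool (vertex T \<in> \<alpha>)) * (v \<beta> * of_bool (vertex T \<in> \<beta>))))"
    unfolding moment_matrix_def sum_distrib_left sum_distrib_right
    by (intro sum.cong refl) auto
  also have "\<dots> = (\<Sum>\<alpha>\<in>I. \<Sum>T\<in>UNIV. \<Sum>\<beta>\<in>I.
       p T * ((v \<alpha> * of_bool (vertex T \<in> \<alpha>)) * (v \<beta> * of_bool (vertex T \<in> \<beta>))))"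
    by (intro sum.cong refl sum.swap)
  also have "\<dots> = (\<Sum>T\<in>UNIV. \<Sum>\<alpha>\<in>I. \<Sum>\<beta>\<in>I.
       p T * ((v \<alpha> * of_bool (vertex T \<in> \<alpha>)) * (v \<beta> * of_bool (vertex T \<in> \<beta>))))"
    by (rule sum.swap)
  also have "\<dots> = (\<Sum>T\<in>UNIV. p T * (\<Sum>\<alpha>\<in>I. v \<alpha> * of_bool (vertex T \<in> \<alpha>))\<^sup>2)"
    by (simp only: power2_eq_square sum_product) (simp only: sum_distrib_left)
  finally show ?thesis .
qed

lemma moment_matrix_sym: "moment_matrix p \<alpha> \<beta> = moment_matrix p \<beta> \<alpha>"
  by (simp add: moment_matrix_def Int_commute)

lemma sym_psd_on_moment_matrix_iff:
  "sym_psd_on I (moment_matrix p) \<longleftrightarrow>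
     (\<forall>v. 0 \<le> (\<Sum>T\<in>UNIV. p T * (\<Sum>\<alpha>\<in>I. v \<alpha> * of_bool (vertex T \<in> \<alpha>))\<^sup>2))"
  by (simp add: sym_psd_on_def moment_matrix_quadratic_form)
     (simp add: moment_matrix_sym)

lemma sym_psd_on_moment_matrix:
  assumes "\<And>T. 0 \<le> p T" shows "sym_psd_on I (moment_matrix p)"
  unfolding sym_psd_on_moment_matrix_iff by (simp add: sum_nonneg assms)

text \<open>Intersecting with \<open>ones {j}\<close> restricts the measure to the sets containing \<open>j\<close>; summing over
  \<open>j\<close> with weights \<open>A\<^sub>i\<^sub>j\<close> thus weights each vertex with its value under row \<open>i\<close>.\<close>

lemma slack_matrix_moment_matrix:
  "slack_matrix A b (moment_matrix p) i =
     moment_matrix (\<lambda>T. p T * (b $ i - (A *v vertex T) $ i))"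
proof (intro ext)
  fix \<alpha> \<beta> :: "(real^'a) set"
  let ?m = "\<lambda>T. of_bool (vertex T \<in> \<alpha> \<inter> \<beta>) :: real"
  have "(\<Sum>j\<in>UNIV. A $ i $ j * moment_matrix p (\<alpha> \<inter> ones {j}) (\<beta> \<inter> ones {j}))
      = (\<Sum>j\<in>UNIV. \<Sum>T\<in>UNIV. p T * ?m T * (A $ i $ j * of_bool (j \<in> T)))"
    unfolding moment_matrix_def sum_distrib_left
    by (intro sum.cong refl) (auto simp: vertex_in_ones_iff)
  also have "\<dots> = (\<Sum>T\<in>UNIV. \<Sum>j\<in>UNIV. p T * ?m T * (A $ i $ j * of_bool (j \<in> T)))"
    by (rule sum.swap)
  also have "\<dots> = (\<Sum>T\<in>UNIV. p T * ?m T * (A *v vertex T) $ i)"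
    by (simp only: matrix_vector_mult_vertex sum_distrib_left)
  finally show "slack_matrix A b (moment_matrix p) i \<alpha> \<beta> =
      moment_matrix (\<lambda>T. p T * (b $ i - (A *v vertex T) $ i)) \<alpha> \<beta>"
    unfolding slack_matrix_def
    by (simp only: moment_matrix_def sum_distrib_left flip: sum_subtractf)
       (simp only: algebra_simps)
qed

text \<open>The moment matrix of \<open>p\<close> is the lift; consistency is automatic because its entries depend
  on \<open>\<alpha> \<inter> \<beta>\<close> only.\<close>

lemma barycenter_in_las:
  fixes A :: "real^'n^'m" and p :: "'n set \<Rightarrow> real"
  assumes "k \<noteq> 0" and nonneg: "\<And>T. 0 \<le> p T" and total: "sum p UNIV = 1"
    and slack: "\<And>i. sym_psd_on (aplus k) (slack_matrix A b (moment_matrix p) i)"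
  shows "(\<Sum>T\<in>UNIV. p T *\<^sub>R vertex T) \<in> las k A b"
proof -
  have mass: "moment_matrix p cube01 cube01 = 1"
    by (simp add: moment_matrix_def vertex_in_cube01 total)
  have "moment_matrix p \<in> las_lift k A b"
    unfolding las_lift_def using mass slack
    by (auto intro: sym_psd_on_moment_matrix nonneg simp: moment_matrix_def)
  moreover have "moment_matrix p (ones {i}) cube01 = (\<Sum>T\<in>UNIV. p T *\<^sub>R vertex T) $ i" for i
    by (simp add: moment_matrix_def vertex_in_ones_iff vertex_in_cube01 vertex_nth)
  ultimately show ?thesis
    using \<open>k \<noteq> 0\<close> mass by (auto simp: las_def)
qed

section \<open>At level n the Lasserre operator yields the integer hull\<close>

text \<open>The weights of a convex combination of feasible vertices form a measure for which all slacks
  are nonnegative.\<close>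

lemma integer_hull_subset_las:
  fixes A :: "real^'n^'m"
  assumes "k \<noteq> 0"
  shows "integer_hull (box_polytope A b) \<subseteq> las k A b"
proof
  fix x assume "x \<in> integer_hull (box_polytope A b)"
  moreover have hull: "box_polytope A b \<inter> cube01 = vertex ` {T. vertex T \<in> box_polytope A b}"
    by (auto simp: cube01_eq_range_vertex)
  ultimately obtain u where u: "\<And>z. z \<in> vertex ` {T. vertex T \<in> box_polytope A b} \<Longrightarrow> 0 \<le> u z"
      "sum u (vertex ` {T. vertex T \<in> box_polytope A b}) = 1"
      "(\<Sum>z\<in>vertex ` {T. vertex T \<in> box_polytope A b}. u z *\<^sub>R z) = x"
    by (auto simp: integer_hull_def hull convex_hull_finite simp del: image_eqI)
  define p where "p T = (if vertex T \<in> box_polytope A b then u (vertex T) else 0)" for T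
  have nonneg: "0 \<le> p T" for T using u(1) by (auto simp: p_def)
  have total: "sum p UNIV = 1"
    using u(2) by (simp add: p_def sum.inter_filter[symmetric] sum.reindex inj_on_subset[OF inj_vertex])
  have "(\<Sum>T\<in>UNIV. p T *\<^sub>R vertex T) = (\<Sum>T\<in>UNIV. if vertex T \<in> box_polytope A b then u (vertex T) *\<^sub>R vertex T else 0)"
    by (rule sum.cong) (auto simp: p_def)
  also have "\<dots> = x"
    using u(3) by (simp add: sum.inter_filter[symmetric] sum.reindex inj_on_subset[OF inj_vertex])
  finally have bary: "(\<Sum>T\<in>UNIV. p T *\<^sub>R vertex T) = x" .
  have "0 \<le> p T * (b $ i - (A *v vertex T) $ i)" for T i
    using nonneg[of T] by (auto simp: p_def box_polytope_def)
  then have "sym_psd_on (aplus k) (slack_matrix A b (moment_matrix p) i)" for i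
    unfolding slack_matrix_moment_matrix by (rule sym_psd_on_moment_matrix)
  then show "x \<in> las k A b"
    using barycenter_in_las[OF assms nonneg total, of A b] by (simp only: bary)
qed

text \<open>An interval of the Boolean lattice with more than one element has equally many even and odd
  members. Both Moebius inversion and the orthogonality of low degree polynomials to the full character
  reduce to this.\<close>

lemma alternating_sum_interval:
  fixes S W :: "'a::finite set"
  shows "(\<Sum>T | S \<subseteq> T \<and> T \<subseteq> W. (-1) ^ card T) = (of_bool (S = W) * (-1) ^ card W :: real)"
proof (cases "S \<subset> W")
  case True
  then show ?thesis
    using card_subsupersets_even_odd[of W S]
    by (subst sum_alternating_cancels) (simp_all add: conj_ac)
next
  case False
  then have "{T. S \<subseteq> T \<and> T \<subseteq> W} = (if S = W then {W} else {})" by auto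
  then show ?thesis by auto
qed

text \<open>Any prescribed moments \<open>y\<close> come from a unique signed measure; this gives it explicitly.\<close>

lemma moebius_inversion_supersets:
  fixes y :: "'a::finite set \<Rightarrow> real"
  assumes p: "\<And>T. p T = (\<Sum>U\<in>UNIV. of_bool (T \<subseteq> U) * (-1) ^ (card U + card T) * y U)"
  shows "(\<Sum>T\<in>UNIV. p T * of_bool (S \<subseteq> T)) = y S"
proof -
  have "(\<Sum>T\<in>UNIV. p T * of_bool (S \<subseteq> T)) =
    (\<Sum>T\<in>UNIV. \<Sum>U\<in>UNIV. (-1) ^ card U * y U * (of_bool (S \<subseteq> T \<and> T \<subseteq> U) * (-1) ^ card T))"
    unfolding p sum_distrib_right by (intro sum.cong refl) (auto simp: power_add)
  also have "\<dots> = (\<Sum>U\<in>UNIV. \<Sum>T\<in>UNIV. (-1) ^ card U * y U * (of_bool (S \<subseteq> T \<and> T \<subseteq> U) * (-1) ^ card T))"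
    by (rule sum.swap)
  also have "\<dots> = (\<Sum>U\<in>UNIV. (-1) ^ card U * y U * (\<Sum>T | S \<subseteq> T \<and> T \<subseteq> U. (-1) ^ card T))"
    by (simp add: sum_distrib_left sum.inter_filter[symmetric] of_bool_def if_distrib if_distribR cong: if_cong)
  also have "\<dots> = (\<Sum>U\<in>UNIV. if S = U then y U else 0)"
    unfolding alternating_sum_interval by (intro sum.cong refl) (auto simp flip: power_add)
  also have "\<dots> = y S" by simp
  finally show ?thesis .
qed

lemma indicator_as_combination_of_ones:
  fixes T :: "'n::finite set"
  obtains v where "\<And>R. (\<Sum>\<alpha>\<in>range ones. v \<alpha> * of_bool (vertex R \<in> \<alpha>)) = (of_bool (R = T) :: real)"
proof
  \<comment> \<open>The coefficients of \<open>\<Prod>\<^bsub>i\<in>T\<^esub> x\<^sub>i \<Prod>\<^bsub>i\<notin>T\<^esub> (1 - x\<^sub>i)\<close> in the monomials \<open>ones U\<close>.\<close>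
  define v :: "(real^'n) set \<Rightarrow> real"
    where "v \<alpha> = of_bool (T \<subseteq> inv ones \<alpha>) * (-1) ^ (card (inv ones \<alpha>) + card T)" for \<alpha>
  fix R :: "'n set"
  have "(\<Sum>\<alpha>\<in>range ones. v \<alpha> * of_bool (vertex R \<in> \<alpha>)) =
      (\<Sum>U\<in>UNIV. v (ones U) * of_bool (U \<subseteq> R))"
    unfolding sum.reindex[OF inj_ones] by (simp only: o_def vertex_in_ones_iff)
  also have "\<dots> = (\<Sum>U\<in>UNIV. (-1) ^ card T * (of_bool (T \<subseteq> U \<and> U \<subseteq> R) * (-1) ^ card U))"
    by (intro sum.cong refl) (auto simp: v_def inv_f_f inj_ones power_add)
  also have "\<dots> = (-1) ^ card T * (\<Sum>U | T \<subseteq> U \<and> U \<subseteq> R. (-1) ^ card U)"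
    by (simp add: sum_distrib_left sum.inter_filter[symmetric] of_bool_def if_distrib if_distribR cong: if_cong)
  also have "\<dots> = of_bool (R = T)"
    unfolding alternating_sum_interval by (auto simp flip: power_add)
  finally show "(\<Sum>\<alpha>\<in>range ones. v \<alpha> * of_bool (vertex R \<in> \<alpha>)) = (of_bool (R = T) :: real)" .
qed

text \<open>The form at the coefficients of the indicator of \<open>T\<close> is \<open>p T\<close> itself.\<close>

lemma measure_nonneg_if_full_moment_matrix_psd:
  fixes p :: "'n::finite set \<Rightarrow> real"
  assumes "sym_psd_on (range ones) (moment_matrix p)"
  shows "0 \<le> p T"
proof -
  obtain v where v: "\<And>R. (\<Sum>\<alpha>\<in>range ones. v \<alpha> * of_bool (vertex R \<in> \<alpha>)) = (of_bool (R = T) :: real)"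
    using indicator_as_combination_of_ones[of T] by blast
  have "0 \<le> (\<Sum>R\<in>UNIV. p R * (of_bool (R = T))\<^sup>2)"
    using assms unfolding sym_psd_on_moment_matrix_iff by (metis (no_types, lifting) v sum.cong)
  also have "\<dots> = (\<Sum>R\<in>UNIV. if R = T then p R else 0)"
    by (intro sum.cong refl) auto
  also have "\<dots> = p T" by simp
  finally show ?thesis .
qed

lemma sym_psd_on_cong:
  assumes "\<And>\<alpha> \<beta>. \<alpha> \<in> I \<Longrightarrow> \<beta> \<in> I \<Longrightarrow> M \<alpha> \<beta> = N \<alpha> \<beta>"
  shows "sym_psd_on I M \<longleftrightarrow> sym_psd_on I N"
  using assms by (simp add: sym_psd_on_def cong: sum.cong)

text \<open>The full moment matrix forces \<open>p \<ge> 0\<close>, and each full slack matrix forces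
  \<open>p(T)\<close> times the slack at \<open>T\<close> to be nonnegative, so \<open>p\<close> is supported on the feasible vertices.\<close>

lemma las_card_subset_integer_hull:
  fixes A :: "real^'n^'m"
  shows "las CARD('n) A b \<subseteq> integer_hull (box_polytope A b)"
proof
  fix x assume "x \<in> las CARD('n) A b"
  then obtain Y where Y: "Y \<in> las_lift CARD('n) A b"
    and x: "\<And>i. Y (ones {i}) cube01 = x $ i"
    by (auto simp: las_def split: if_splits)
  define p where "p T = (\<Sum>U\<in>UNIV. of_bool (T \<subseteq> U) * (-1) ^ (card U + card T) * Y (ones U) cube01)"
    for T :: "'n set"
  have cons: "Y (ones S) (ones S') = Y (ones (S \<union> S')) cube01" for S S'
  proof -
    have "ones S \<inter> ones S' = ones (S \<union> S') \<inter> cube01"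
      by (auto simp: ones_def)
    moreover have "cube01 \<in> range ones"
      using ones_empty by (metis rangeI)
    moreover have "aplus (CARD('n) + 1) = (range ones :: (real^'n) set set)"
      by (simp add: aplus_eq_range_ones)
    moreover have "\<forall>\<alpha>1\<in>aplus (CARD('n) + 1). \<forall>\<alpha>2\<in>aplus (CARD('n) + 1).
        \<forall>\<beta>1\<in>aplus (CARD('n) + 1). \<forall>\<beta>2\<in>aplus (CARD('n) + 1).
          \<alpha>1 \<inter> \<beta>1 = \<alpha>2 \<inter> \<beta>2 \<longrightarrow> Y \<alpha>1 \<beta>1 = Y \<alpha>2 \<beta>2"
      using Y unfolding las_lift_def by blast
    ultimately show ?thesis by (metis rangeI)
  qed
  have Y_moment: "Y \<alpha> \<beta> = moment_matrix p \<alpha> \<beta>" if \<alpha>: "\<alpha> \<in> range ones" and \<beta>: "\<beta> \<in> range ones" for \<alpha> \<beta>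
  proof -
    obtain S S' where "\<alpha> = ones S" "\<beta> = ones S'" using \<alpha> \<beta> by blast
    moreover have "moment_matrix p (ones S) (ones S') = Y (ones (S \<union> S')) cube01"
      using moebius_inversion_supersets[of p, OF p_def, of "S \<union> S'"]
      by (simp add: moment_matrix_def vertex_in_ones_iff)
    ultimately show ?thesis by (simp add: cons)
  qed
  have full: "aplus CARD('n) = (range ones :: (real^'n) set set)"
      "aplus (CARD('n) + 1) = (range ones :: (real^'n) set set)"
    by (simp_all add: aplus_eq_range_ones)
  have "sym_psd_on (range ones) Y"
    using Y unfolding las_lift_def full by simp
  then have "sym_psd_on (range ones) (moment_matrix p)"
    using sym_psd_on_cong[of "range ones" Y "moment_matrix p"] Y_moment by simp
  then have nonneg: "0 \<le> p T" for T
    by (rule measure_nonneg_if_full_moment_matrix_psd)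
  have slack: "0 \<le> p T * (b $ i - (A *v vertex T) $ i)" for T i
  proof -
    have "slack_matrix A b Y i \<alpha> \<beta> = slack_matrix A b (moment_matrix p) i \<alpha> \<beta>"
      if "\<alpha> \<in> range ones" "\<beta> \<in> range ones" for \<alpha> \<beta>
    proof -
      have "\<gamma> \<inter> ones {j} \<in> range ones" if "\<gamma> \<in> range ones" for \<gamma> :: "(real^'n) set" and j
        using that by (auto simp flip: ones_Un)
      then show ?thesis
        using that by (simp add: slack_matrix_def Y_moment)
    qed
    then have "sym_psd_on (range ones) (slack_matrix A b (moment_matrix p) i)"
      using Y sym_psd_on_cong[of "range ones" "slack_matrix A b Y i" "slack_matrix A b (moment_matrix p) i"]
      by (simp add: las_lift_def full)
    then show ?thesis
      unfolding slack_matrix_moment_matrix by (rule measure_nonneg_if_full_moment_matrix_psd)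
  qed
  define V where "V = {T. vertex T \<in> box_polytope A b}"
  have zero: "p T = 0" if T: "T \<notin> V" for T
  proof -
    obtain i where "(A *v vertex T) $ i > b $ i"
      using T by (auto simp: V_def box_polytope_def vertex_nth not_le)
    then show ?thesis
      using slack[of T i] nonneg[of T] by (simp add: zero_le_mult_iff)
  qed
  have total: "sum p UNIV = 1"
    using moebius_inversion_supersets[of p, OF p_def, of "{}"] Y
    by (simp add: ones_empty las_lift_def)
  have "(\<Sum>T\<in>V. p T *\<^sub>R vertex T) \<in> integer_hull (box_polytope A b)"
    unfolding integer_hull_def
  proof (rule convex_sum)
    show "sum p V = 1"
      using total zero by (metis (no_types, lifting) Diff_iff UNIV_I finite subset_UNIV sum.mono_neutral_cong_left)
    show "vertex T \<in> convex hull (box_polytope A b \<inter> cube01)" if "T \<in> V" for T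
      using that by (auto simp: V_def vertex_in_cube01 intro: hull_inc)
  qed (auto simp: nonneg)
  also have "(\<Sum>T\<in>V. p T *\<^sub>R vertex T) = (\<Sum>T\<in>UNIV. p T *\<^sub>R vertex T)"
    by (rule sum.mono_neutral_left) (auto simp: zero)
  also have "\<dots> = x"
    using moebius_inversion_supersets[of p, OF p_def, of "{i}" for i]
    by (simp add: vec_eq_iff vertex_def x)
  finally show "x \<in> integer_hull (box_polytope A b)" .
qed


section \<open>Below level n a point outside the integer hull survives\<close>

lemma weighted_Cauchy_Schwarz:
  fixes w g s :: "'a \<Rightarrow> real"
  assumes pos: "\<And>a. a \<in> A \<Longrightarrow> 0 < w a" and sign: "\<And>a. a \<in> A \<Longrightarrow> (s a)\<^sup>2 = 1"
  shows "(\<Sum>a\<in>A. s a * g a)\<^sup>2 \<le> (\<Sum>a\<in>A. 1 / w a) * (\<Sum>a\<in>A. w a * (g a)\<^sup>2)"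
proof -
  have "(\<Sum>a\<in>A. s a * g a) = (\<Sum>a\<in>A. (s a / sqrt (w a)) * (sqrt (w a) * g a))"
    using pos by (intro sum.cong refl) force
  then have "(\<Sum>a\<in>A. s a * g a)\<^sup>2
      \<le> (\<Sum>a\<in>A. (s a / sqrt (w a))\<^sup>2) * (\<Sum>a\<in>A. (sqrt (w a) * g a)\<^sup>2)"
    by (simp only: Cauchy_Schwarz_ineq_sum)
  also have "(\<Sum>a\<in>A. (s a / sqrt (w a))\<^sup>2) = (\<Sum>a\<in>A. 1 / w a)"
    using pos sign by (intro sum.cong refl) (auto simp: power_divide less_imp_le)
  also have "(\<Sum>a\<in>A. (sqrt (w a) * g a)\<^sup>2) = (\<Sum>a\<in>A. w a * (g a)\<^sup>2)"
    using pos by (intro sum.cong refl) (auto simp: power_mult_distrib less_imp_le)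
  finally show ?thesis .
qed

text \<open>A set \<open>S\<close> of size at most \<open>k < n\<close> is proper, so the sets above it have alternating sum
  zero; the inner sums are linear combinations of such families.\<close>

lemma alternating_sum_low_degree_eq_0:
  assumes "k < CARD('n)"
  shows "(\<Sum>T\<in>UNIV. (-1) ^ card T *
     (\<Sum>\<alpha>\<in>aplus k. v \<alpha> * of_bool (vertex (T :: 'n::finite set) \<in> \<alpha>))) = (0 :: real)"
proof -
  have "(\<Sum>T\<in>UNIV. (-1) ^ card T * of_bool (vertex T \<in> \<alpha>)) = (0 :: real)"
    if "\<alpha> \<in> aplus k" for \<alpha> :: "(real^'n) set"
  proof -
    obtain S :: "'n set" where S: "\<alpha> = ones S" "card S \<le> k" using \<open>\<alpha> \<in> aplus k\<close> by (auto simp: aplus_def)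
    then have "S \<noteq> UNIV" using assms by auto
    then show ?thesis
      using alternating_sum_interval[of S UNIV] by (simp add: S(1) vertex_in_ones_iff)
  qed
  then have "(\<Sum>\<alpha>\<in>aplus k. v \<alpha> *
      (\<Sum>T\<in>UNIV. (-1) ^ card T * of_bool (vertex (T :: 'n set) \<in> \<alpha>))) = 0"
    by simp
  also have "(\<Sum>\<alpha>\<in>aplus k. v \<alpha> *
      (\<Sum>T\<in>UNIV. (-1) ^ card T * of_bool (vertex (T :: 'n set) \<in> \<alpha>)))
      = (\<Sum>T\<in>UNIV. \<Sum>\<alpha>\<in>aplus k. v \<alpha> * ((-1) ^ card T * of_bool (vertex T \<in> \<alpha>)))"
    by (simp only: sum_distrib_left) (rule sum.swap)
  also have "\<dots> = (\<Sum>T\<in>UNIV. (-1) ^ card T *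
     (\<Sum>\<alpha>\<in>aplus k. v \<alpha> * of_bool (vertex T \<in> \<alpha>)))"
    by (simp only: sum_distrib_left) (simp only: mult.left_commute)
  finally show ?thesis .
qed

text \<open>The full set may carry negative weight: orthogonality to \<open>(-1)\<^bsup>|T|\<^esup>\<close> together with
  Cauchy-Schwarz bounds \<open>g([n])\<^sup>2\<close> by \<open>\<Sum> 1/w(T)\<close> times the positive part of the form.\<close>

lemma truncated_moment_matrix_psd:
  fixes w :: "'n::finite set \<Rightarrow> real"
  assumes k: "k < CARD('n)"
    and pos: "\<And>T. T \<noteq> UNIV \<Longrightarrow> 0 < w T" and neg: "w UNIV \<le> 0"
    and small: "- w UNIV * (\<Sum>T\<in>-{UNIV}. 1 / w T) \<le> 1"
  shows "sym_psd_on (aplus k) (moment_matrix w)"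
  unfolding sym_psd_on_moment_matrix_iff
proof
  fix v :: "(real^'n) set \<Rightarrow> real"
  define g where "g T = (\<Sum>\<alpha>\<in>aplus k. v \<alpha> * of_bool (vertex T \<in> \<alpha>))" for T :: "'n set"
  define Q where "Q = (\<Sum>T\<in>-{UNIV}. w T * (g T)\<^sup>2)"
  have split: "sum f UNIV = f UNIV + sum f (-{UNIV})" for f :: "'n set \<Rightarrow> real"
    by (simp add: sum.remove[of UNIV UNIV] Compl_eq_Diff_UNIV)
  have "0 \<le> Q"
    unfolding Q_def using pos by (intro sum_nonneg) (simp add: less_imp_le)
  have "(-1) ^ CARD('n) * g UNIV = - (\<Sum>T\<in>-{UNIV}. (-1) ^ card T * g T)"
    using alternating_sum_low_degree_eq_0[OF k, of v] by (simp add: split g_def)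
  then have "((-1) ^ CARD('n) * g UNIV)\<^sup>2 = (\<Sum>T\<in>-{UNIV}. (-1) ^ card T * g T)\<^sup>2"
    by simp
  then have "(g UNIV)\<^sup>2 = (\<Sum>T\<in>-{UNIV}. (-1) ^ card T * g T)\<^sup>2"
    by (simp add: power_mult_distrib flip: power_mult)
  also have "\<dots> \<le> (\<Sum>T\<in>-{UNIV}. 1 / w T) * Q"
    unfolding Q_def by (rule weighted_Cauchy_Schwarz) (auto simp: pos simp flip: power_mult)
  finally have "- w UNIV * (g UNIV)\<^sup>2 \<le> - w UNIV * ((\<Sum>T\<in>-{UNIV}. 1 / w T) * Q)"
    using neg by (intro mult_left_mono) auto
  also have "\<dots> \<le> 1 * Q"
    using mult_right_mono[OF small \<open>0 \<le> Q\<close>] by (simp only: mult.assoc)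
  finally show "0 \<le> (\<Sum>T\<in>UNIV. w T * (\<Sum>\<alpha>\<in>aplus k. v \<alpha> * of_bool (vertex T \<in> \<alpha>))\<^sup>2)"
    by (simp add: split Q_def flip: g_def)
qed

lemma card_facet_vertices:
  "card {T :: 'n::finite set. card T = CARD('n) - 1} = CARD('n)"
proof -
  have "card {T :: 'n set. card T = CARD('n) - 1} = CARD('n) choose (CARD('n) - 1)"
    using n_subsets[of "UNIV :: 'n set" "CARD('n) - 1"] by simp
  also have "\<dots> = CARD('n)"
    using binomial_Suc_n[of "CARD('n) - 1"] Suc_pred'[of "CARD('n)"] by (metis zero_less_card_finite)
  finally show ?thesis .
qed

text \<open>Only three groups of vertices matter: those below level \<open>n - 1\<close>, the \<open>n\<close> at level
  \<open>n - 1\<close>, and the full set, which alone is cut off.\<close>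

lemma sum_by_level:
  fixes f :: "'n::finite set \<Rightarrow> real"
  shows "sum f (-{UNIV}) = sum f {T. card T < CARD('n) - 1} + sum f {T. card T = CARD('n) - 1}"
    and "sum f UNIV = sum f {T. card T < CARD('n) - 1} + sum f {T. card T = CARD('n) - 1} + f UNIV"
proof -
  let ?L = "{T :: 'n set. card T < CARD('n) - 1}" and ?F = "{T :: 'n set. card T = CARD('n) - 1}"
  have "T \<in> -{UNIV} \<longleftrightarrow> T \<in> ?L \<union> ?F" for T :: "'n set"
  proof -
    have "T \<noteq> UNIV \<longleftrightarrow> card T < CARD('n)"
      using psubset_card_mono[of UNIV T] by auto
    also have "\<dots> \<longleftrightarrow> card T < CARD('n) - 1 \<or> card T = CARD('n) - 1"
      using zero_less_card_finite[where 'a='n] by linarith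
    finally show ?thesis by simp
  qed
  then have "-{UNIV} = ?L \<union> ?F" by (rule set_eqI)
  moreover have "sum f (?L \<union> ?F) = sum f ?L + sum f ?F"
    by (rule sum.union_disjoint) auto
  ultimately show *: "sum f (-{UNIV}) = sum f ?L + sum f ?F" by (simp only:)
  have "sum f UNIV = f UNIV + sum f (-{UNIV})"
    using sum.remove[of UNIV UNIV f] by (simp add: Compl_eq_Diff_UNIV)
  then show "sum f UNIV = sum f ?L + sum f ?F + f UNIV" unfolding * by simp
qed

lemma card_low_vertices:
  "real (card {T :: 'n::finite set. card T < CARD('n) - 1}) = 2 ^ CARD('n) - real CARD('n) - 1"
  using sum_by_level(2)[of "\<lambda>T :: 'n set. 1"]
  unfolding sum_constant card_facet_vertices by (simp add: card_UNIV_set)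

text \<open>The full set gets a small mass \<open>\<epsilon>\<close> and raises the mean cardinality above \<open>n - 1\<close> by \<open>\<epsilon>\<close>. A
  set \<open>T\<close> at distance \<open>m(T) = n - 1 - |T| \<ge> 1\<close> below level \<open>n - 1\<close> lowers it by
  \<open>p(T) m(T)\<close>; taking \<open>p(T) = \<epsilon> / (c m(T))\<close> spreads this loss evenly, for a total of
  \<open>\<epsilon> N / c\<close>, which is below \<open>\<epsilon>\<close> iff \<open>c > N\<close>. The sets below level \<open>n - 1\<close> contribute
  at most \<open>\<rho> N c\<close> to the smallness condition, whatever \<open>\<epsilon>\<close> is, so \<open>c\<close> can be chosen when
  \<open>\<rho> N\<^sup>2 < 1\<close>. All remaining mass is spread over level \<open>n - 1\<close>, and the contribution of
  that level tends to zero with \<open>\<epsilon>\<close>.\<close>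

lemma fooling_measure_exists:
  fixes \<rho> :: real
  defines "n \<equiv> CARD('n::finite)"
  defines "N \<equiv> real (card {T :: 'n::finite set. card T < n - 1})"
  assumes n: "n \<ge> 2" and \<rho>: "0 < \<rho>" "\<rho> < 1" and small: "\<rho> * N\<^sup>2 < 1"
  obtains p :: "'n::finite set \<Rightarrow> real" where
    "\<And>T. 0 < p T" "sum p UNIV = 1" "(\<Sum>T\<in>UNIV. p T * card T) > real n - 1"
    "\<rho> * p UNIV * (\<Sum>T\<in>-{UNIV}. 1 / (p T * (n - \<rho> - card T))) \<le> 1"
proof -
  define L where "L = {T :: 'n set. card T < n - 1}"
  define F where "F = {T :: 'n set. card T = n - 1}"
  define m where "m T = real n - 1 - card T" for T :: "'n set"
  note levels = sum_by_level[where 'n='n, folded n_def, folded L_def F_def]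
  have card_F: "card F = n"
    using card_facet_vertices[where 'n='n] by (simp add: F_def n_def)
  have N: "N = card L" by (simp add: N_def L_def)
  have "{} \<in> L" using n by (simp add: L_def)
  then have "card L > 0" by (auto simp: card_gt_0_iff)
  then have "N \<ge> 1" unfolding N by linarith
  have m: "m T \<ge> 1" if "T \<in> L" for T
    using that unfolding L_def m_def by simp
  have "N < 1 / (\<rho> * N)"
    using small \<rho> \<open>N \<ge> 1\<close> by (simp add: field_simps power2_eq_square)
  then obtain c where c: "N < c" "c < 1 / (\<rho> * N)" using dense by blast
  have "c > 0" using c \<open>N \<ge> 1\<close> by linarith
  have "\<rho> * N * c < 1"
    using c(2) \<rho> \<open>N \<ge> 1\<close> by (simp add: field_simps)
  \<comment> \<open>The first bound leaves mass at least \<open>1/2\<close> for level \<open>n - 1\<close>; the second makes the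
    contribution of that level fit into \<open>1 - \<rho> N c\<close>.\<close>
  define \<epsilon> where "\<epsilon> = min (1/4) ((1 - \<rho> * N * c) * (1 - \<rho>) / (2 * \<rho> * (real n)\<^sup>2))"
  have \<epsilon>: "0 < \<epsilon>" "\<epsilon> \<le> 1/4" "\<epsilon> \<le> (1 - \<rho> * N * c) * (1 - \<rho>) / (2 * \<rho> * (real n)\<^sup>2)"
    using \<open>\<rho> * N * c < 1\<close> \<rho> n by (auto simp: \<epsilon>_def)
  define Q where "Q = (\<Sum>T\<in>L. 1 / (c * m T))"
  have "Q \<le> (\<Sum>T\<in>L. 1 / c)"
    unfolding Q_def
  proof (rule sum_mono)
    fix T assume "T \<in> L"
    then have "c * 1 \<le> c * m T" using m \<open>c > 0\<close> by (intro mult_left_mono) auto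
    then show "1 / (c * m T) \<le> 1 / c" using \<open>c > 0\<close> by (intro frac_le) auto
  qed
  also have "\<dots> < 1" using c \<open>c > 0\<close> by (simp add: N)
  finally have "Q < 1" .
  define a where "a = (1 - \<epsilon> - \<epsilon> * Q) / n"
  have "\<epsilon> * Q \<le> \<epsilon>" using \<epsilon>(1) \<open>Q < 1\<close> by (simp add: mult_left_le)
  then have "1 / 2 \<le> 1 - \<epsilon> - \<epsilon> * Q" using \<epsilon>(2) by linarith
  then have a: "a \<ge> 1 / (2 * n)"
    using divide_right_mono[of "1 / 2" "1 - \<epsilon> - \<epsilon> * Q" "real n"] by (simp add: a_def)
  moreover have "1 / (2 * real n) > 0" using n by simp
  ultimately have "a > 0" by linarith
  define p where "p T = (if T = UNIV then \<epsilon> else if T \<in> F then a else \<epsilon> / (c * m T))" for T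
  have p_UNIV: "p UNIV = \<epsilon>" by (simp add: p_def)
  have not_UNIV: "T \<noteq> UNIV" if "T \<in> L \<union> F" for T
    using that n by (auto simp: L_def F_def n_def)
  have p_F: "p T = a" if "T \<in> F" for T
    using that not_UNIV[of T] by (simp add: p_def)
  have p_L: "p T = \<epsilon> / (c * m T)" if "T \<in> L" for T
    using that not_UNIV[of T] by (auto simp: p_def L_def F_def)
  have m_F: "m T = 0" if "T \<in> F" for T
    using that n by (simp add: m_def F_def of_nat_diff)
  have total: "sum p UNIV = 1"
  proof -
    have "sum p L = \<epsilon> * Q" unfolding Q_def sum_distrib_left by (simp add: p_L)
    moreover have "sum p F = 1 - \<epsilon> - \<epsilon> * Q" using n by (simp add: p_F card_F a_def)
    ultimately show ?thesis by (simp add: levels(2) p_UNIV)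
  qed
  show ?thesis
  proof
    show "0 < p T" for T
    proof (cases "T = UNIV \<or> T \<in> F")
      case False
      then have "T \<in> L"
        using levels(1)[of "\<lambda>U. of_bool (U = T)"] by (auto simp: of_bool_def split: if_splits)
      then show ?thesis using p_L m[of T] \<epsilon>(1) \<open>c > 0\<close> by simp
    qed (use \<epsilon> \<open>a > 0\<close> in \<open>auto simp: p_def\<close>)
    show "sum p UNIV = 1" by (fact total)
    have "(\<Sum>T\<in>UNIV. p T * card T) - (real n - 1) * sum p UNIV = (\<Sum>T\<in>UNIV. - (p T * m T))"
      unfolding sum_distrib_left sum_subtractf[symmetric]
      by (intro sum.cong refl) (simp add: m_def algebra_simps)
    also have "\<dots> = \<epsilon> - (\<Sum>T\<in>L. p T * m T)"
      by (simp add: levels(2) m_F p_UNIV sum_negf) (simp add: m_def n_def)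
    also have "(\<Sum>T\<in>L. p T * m T) = (\<Sum>T\<in>L. \<epsilon> / c)"
      using m by (intro sum.cong refl) (force simp: p_L)
    also have "\<dots> = \<epsilon> * (N / c)" by (simp add: N)
    also have "\<epsilon> - \<epsilon> * (N / c) > 0"
      using c(1) \<open>c > 0\<close> \<epsilon>(1) by (simp add: field_simps)
    finally show "(\<Sum>T\<in>UNIV. p T * card T) > real n - 1" by (simp add: total)
    have "(\<Sum>T\<in>L. 1 / (p T * (n - \<rho> - card T))) \<le> (\<Sum>T\<in>L. c / \<epsilon>)"
    proof (rule sum_mono)
      fix T assume T: "T \<in> L"
      have "1 / (p T * (n - \<rho> - card T)) = c / \<epsilon> * (m T / (m T + (1 - \<rho>)))"
        by (simp add: p_L[OF T] m_def)
      also have "\<dots> \<le> c / \<epsilon> * 1"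
        using m[OF T] \<rho> \<open>c > 0\<close> \<epsilon>(1) by (intro mult_left_mono) (auto simp: divide_le_eq)
      finally show "1 / (p T * (n - \<rho> - card T)) \<le> c / \<epsilon>" by simp
    qed
    also have "\<dots> = N * c / \<epsilon>" by (simp add: N)
    finally have L_part: "(\<Sum>T\<in>L. 1 / (p T * (n - \<rho> - card T))) \<le> N * c / \<epsilon>" .
    have "(\<Sum>T\<in>F. 1 / (p T * (n - \<rho> - card T))) = (\<Sum>T\<in>F. 1 / (a * (1 - \<rho>)))"
      using m_F by (intro sum.cong refl) (simp add: p_F m_def algebra_simps)
    also have "\<dots> = n / (1 - \<rho>) * (1 / a)" by (simp add: card_F)
    also have "\<dots> \<le> n / (1 - \<rho>) * (2 * n)"
      using a \<open>a > 0\<close> \<rho> n by (intro mult_left_mono) (auto simp: field_simps)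
    finally have F_part: "(\<Sum>T\<in>F. 1 / (p T * (n - \<rho> - card T))) \<le> 2 * (real n)\<^sup>2 / (1 - \<rho>)"
      by (simp add: power2_eq_square mult_ac)
    have "\<rho> * p UNIV * (\<Sum>T\<in>-{UNIV}. 1 / (p T * (n - \<rho> - card T)))
        \<le> \<rho> * \<epsilon> * (N * c / \<epsilon> + 2 * (real n)\<^sup>2 / (1 - \<rho>))"
      unfolding levels(1) p_UNIV
      using L_part F_part \<rho> \<epsilon>(1) by (intro mult_left_mono add_mono) auto
    also have "\<dots> = \<rho> * N * c + \<epsilon> * (2 * \<rho> * (real n)\<^sup>2) / (1 - \<rho>)"
      using \<epsilon>(1) by (simp add: field_simps)
    also have "\<epsilon> * (2 * \<rho> * (real n)\<^sup>2) / (1 - \<rho>) \<le> 1 - \<rho> * N * c"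
      using \<epsilon>(3) \<rho> n by (simp add: field_simps)
    finally show "\<rho> * p UNIV * (\<Sum>T\<in>-{UNIV}. 1 / (p T * (n - \<rho> - card T))) \<le> 1" by simp
  qed
qed

lemma P_mat_mult_vertex: "(P_mat *v vertex T) $ i = real (card T)"
  by (simp add: matrix_vector_mult_vertex P_mat_def)

lemma integer_hull_P_subset:
  fixes \<rho> :: real
  assumes "0 < \<rho>" "n = CARD('n)"
  shows "integer_hull (box_polytope (P_mat :: real^'n^1) (P_rhs n \<rho>)) \<subseteq>
    {x. (\<Sum>i\<in>UNIV. x $ i) \<le> real n - 1}"
  unfolding integer_hull_def
proof (rule hull_minimal)
  show "box_polytope (P_mat :: real^'n^1) (P_rhs n \<rho>) \<inter> cube01 \<subseteq> {x. (\<Sum>i\<in>UNIV. x $ i) \<le> real n - 1}"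
  proof
    fix x :: "real^'n" assume x: "x \<in> box_polytope P_mat (P_rhs n \<rho>) \<inter> cube01"
    then obtain T where T: "x = vertex T" by (auto simp: cube01_eq_range_vertex)
    with x have "real (card T) \<le> real n - \<rho>" by (simp add: box_polytope_P sum_vertex)
    then have "card T < n" using \<open>0 < \<rho>\<close> by linarith
    then show "x \<in> {x. (\<Sum>i\<in>UNIV. x $ i) \<le> real n - 1}" by (simp add: T sum_vertex)
  qed
  have "{x :: real^'n. (\<Sum>i\<in>UNIV. x $ i) \<le> real n - 1} = {x. (\<chi> i. 1) \<bullet> x \<le> real n - 1}"
    by (simp add: inner_vec_def)
  then show "convex {x :: real^'n. (\<Sum>i\<in>UNIV. x $ i) \<le> real n - 1}"
    by (simp add: convex_halfspace_le)
qed

text \<open>For \<open>n \<ge> 5\<close> the crude chain \<open>(2\<^sup>n)\<^sup>2 = 4\<^sup>n \<le> 2 \<cdot> 5\<^bsup>n-1\<^esup> \<le> 2 n\<^bsup>n-1\<^esup>\<close> suffices. It fails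
  for smaller \<open>n\<close>, where the exact number of low vertices is needed.\<close>

lemma bound_on_low_vertices:
  fixes n :: nat
  assumes "n \<ge> 2"
  shows "(2 ^ n - real n - 1)\<^sup>2 * ((real n)\<^sup>2 - 1) < 2 * (real n) ^ (n + 1) - (real n)\<^sup>2 - 1"
proof (cases "n < 5")
  case True
  then have "n = 2 \<or> n = 3 \<or> n = 4" using assms by auto
  then show ?thesis by (elim disjE) simp_all
next
  case False
  define X where "X = real n ^ (n - 1)"
  have n_le: "real n + 1 \<le> 2 ^ n"
    using less_exp[of n] by (metis Suc_leI of_nat_Suc of_nat_le_iff of_nat_numeral of_nat_power add.commute)
  have "(2 ^ n - real n - 1)\<^sup>2 \<le> (2 ^ n)\<^sup>2"
    using n_le by (intro power_mono) auto
  also have "\<dots> = (4 :: real) ^ n"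
    by (simp add: power_mult[symmetric] mult.commute[of n]) (simp add: power_mult)
  also have "\<dots> \<le> 2 * 5 ^ (n - 1)"
  proof -
    have "(4 :: real) ^ (m + 5) \<le> 2 * 5 ^ (m + 4)" for m
      using mult_mono[OF power_mono[of "4 :: real" 5 m], of 1024 1250] by (simp add: power_add)
    moreover obtain m where "n = m + 5"
      using False by (metis le_add_diff_inverse2 not_le)
    ultimately show ?thesis by (simp add: add.commute)
  qed
  also have "\<dots> \<le> 2 * X"
    unfolding X_def using False by (intro mult_left_mono power_mono) auto
  finally have "(2 ^ n - real n - 1)\<^sup>2 * ((real n)\<^sup>2 - 1) \<le> 2 * X * ((real n)\<^sup>2 - 1)"
    using assms by (intro mult_right_mono) auto
  also have "\<dots> < 2 * X * (real n)\<^sup>2 - (real n)\<^sup>2 - 1"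
  proof -
    have "(real n)\<^sup>2 \<le> X"
      unfolding X_def using False by (intro power_increasing) auto
    moreover have "1 < (real n)\<^sup>2" using assms by simp
    ultimately show ?thesis by (simp add: algebra_simps)
  qed
  also have "X * (real n)\<^sup>2 = real n ^ (n + 1)"
    using assms by (simp add: X_def flip: power_add)
  then have "2 * X * (real n)\<^sup>2 = 2 * real n ^ (n + 1)" by simp
  finally show ?thesis .
qed

theorem theorem10:
  fixes n :: nat and \<rho> :: real
  assumes "n = CARD('n::finite)"
    and "n \<ge> 2"
    and "0 < \<rho>"
    and "\<rho> \<le> ((real n)^2 - 1) / (2 * (real n)^(n + 1) - (real n)^2 - 1)"
  shows "has_las_rank (P_mat :: real^'n^1) (P_rhs n \<rho>) n"
proof -
  let ?A = "P_mat :: real^'n^1" and ?b = "P_rhs n \<rho>"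
  let ?hull = "integer_hull (box_polytope ?A ?b)"
  define N where "N = 2 ^ n - real n - 1"
  define D where "D = 2 * (real n)^(n + 1) - (real n)^2 - 1"
  have N_card: "N = real (card {T :: 'n set. card T < CARD('n) - 1})"
    using card_low_vertices[where 'n='n] by (simp add: N_def assms(1))
  have "real n + 2 \<le> 2 ^ n"
    using assms(2) by (induction n rule: dec_induct) auto
  then have "N \<ge> 1" by (simp add: N_def)
  have "1 < (real n)\<^sup>2" using assms(2) by simp
  have D: "N\<^sup>2 * ((real n)\<^sup>2 - 1) < D"
    using bound_on_low_vertices[OF assms(2)] by (simp only: N_def D_def)
  have "D > 0"
    using D \<open>1 < (real n)\<^sup>2\<close> by (smt (verit) mult_nonneg_nonneg zero_le_power2)
  have "\<rho> * N\<^sup>2 \<le> ((real n)\<^sup>2 - 1) / D * N\<^sup>2"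
    using assms(4) by (intro mult_right_mono) (auto simp: D_def)
  also have "\<dots> < 1" using D \<open>D > 0\<close> by (simp add: field_simps)
  finally have small: "\<rho> * N\<^sup>2 < 1" .
  have "\<rho> * 1 \<le> \<rho> * N\<^sup>2"
    using \<open>N \<ge> 1\<close> assms(3) by (intro mult_left_mono) auto
  then have "\<rho> < 1" using small by simp
  obtain p :: "'n set \<Rightarrow> real" where p: "\<And>T. 0 < p T" "sum p UNIV = 1"
      "(\<Sum>T\<in>UNIV. p T * card T) > real n - 1"
      "\<rho> * p UNIV * (\<Sum>T\<in>-{UNIV}. 1 / (p T * (n - \<rho> - card T))) \<le> 1"
    using fooling_measure_exists[where 'n='n and \<rho>=\<rho>] assms(1-3) \<open>\<rho> < 1\<close> small N_card by auto
  have hull: "?hull \<subseteq> {x. (\<Sum>i\<in>UNIV. x $ i) \<le> real n - 1}"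
    by (rule integer_hull_P_subset) (use assms in auto)
  have "las k ?A ?b \<noteq> ?hull" if "k < n" for k
  proof (cases "k = 0")
    case True
    \<comment> \<open>Level 0 is the polytope itself: the point with equal coordinates on its facet
      \<open>\<Sum> x\<^sub>i = n - \<rho>\<close> is outside the hull because \<open>\<rho> < 1\<close>.\<close>
    let ?x = "(\<chi> i. 1 - \<rho> / n) :: real^'n"
    have "(\<Sum>i\<in>UNIV. ?x $ i) = real n - \<rho>"
      using assms(1,2) by (simp add: field_simps)
    moreover have "?x \<in> box_polytope ?A ?b"
      using assms(1-3) \<open>\<rho> < 1\<close> by (simp add: box_polytope_P field_simps)
    ultimately show ?thesis
      using hull \<open>\<rho> < 1\<close> True by (auto simp: las_def)
  next
    case False
    let ?x = "\<Sum>T\<in>UNIV. p T *\<^sub>R vertex T :: real^'n"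
    let ?w = "\<lambda>T :: 'n set. p T * (n - \<rho> - card T)"
    have "slack_matrix ?A ?b (moment_matrix p) i = moment_matrix ?w" for i
      by (simp add: slack_matrix_moment_matrix P_mat_mult_vertex P_rhs_def)
    moreover have "sym_psd_on (aplus k) (moment_matrix ?w)"
    proof (rule truncated_moment_matrix_psd)
      show "k < CARD('n)" using that assms(1) by simp
      show "0 < ?w T" if "T \<noteq> UNIV" for T
      proof -
        have "card T < n" using that assms(1) by (simp add: psubset_card_mono psubset_eq)
        then have "real (card T) \<le> real n - 1" by linarith
        then show ?thesis using p(1)[of T] \<open>\<rho> < 1\<close> by (intro mult_pos_pos) auto
      qed
      show "?w UNIV \<le> 0" using p(1)[of UNIV] assms by (simp add: mult_le_0_iff)
      show "- ?w UNIV * (\<Sum>T\<in>-{UNIV}. 1 / ?w T) \<le> 1"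
        using p(4) by (simp add: assms(1) mult_ac)
    qed
    ultimately have "?x \<in> las k ?A ?b"
      using False p(2) less_imp_le[OF p(1)] by (intro barycenter_in_las) auto
    moreover have "(\<Sum>i\<in>UNIV. ?x $ i) = (\<Sum>T\<in>UNIV. p T * card T)"
    proof -
      have "(\<Sum>i\<in>UNIV. ?x $ i) = (\<Sum>i\<in>UNIV. \<Sum>T\<in>UNIV. p T * vertex T $ i)" by simp
      also have "\<dots> = (\<Sum>T\<in>UNIV. \<Sum>i\<in>UNIV. p T * vertex T $ i)" by (rule sum.swap)
      also have "\<dots> = (\<Sum>T\<in>UNIV. p T * card T)"
        by (simp only: sum_vertex flip: sum_distrib_left)
      finally show ?thesis .
    qed
    ultimately show ?thesis using hull p(3) by fastforce
  qed
  moreover have "las n ?A ?b = ?hull"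
    using las_card_subset_integer_hull[of ?A ?b] integer_hull_subset_las[of n ?A ?b] assms(1,2)
    by auto
  ultimately show ?thesis by (simp add: has_las_rank_def)
qed

end
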